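(* Let $q$ be a prime power and $n\ge 2$. For every integer $r\ge0$ with $r\equiv n\pmod 2$ and $r+2\le n$, we have $c_{r+2}(q,n)<c_r(q,n)$; that is, $c_r(q,n)$ is decreasing in $r$ (over $r$ of the parity of $n$).
   Context: Let ${\mathbb F}_q$ be the finite field of order $q$. A differential on ${\mathbb F}_q^n$ is a linear map $D$ with $D^2=0$; its homology is $\ker D/\operatorname{im}D$, whose dimension has the parity of $n$. $c_r(q,n)$ denotes the number of differentials on ${\mathbb F}_q^n$ whose homology has dimension $r$. *)

theory Defs
  imports "HOL-Analysis.Analysis"
begin

text \<open>A differential on F^n: a linear map D with D o D = 0.\<close>
definition differential :: "('a::field ^ 'n \<Rightarrow> 'a ^ 'n) \<Rightarrow> bool" where
  "differential D \<longleftrightarrow> Vector_Spaces.linear (*s) (*s) D \<and> D \<circ> D = (\<lambda>x. 0)"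

text \<open>Dimension of the homology ker D / im D (im D is a subspace of ker D),
  i.e. dim ker D - dim im D.\<close>
definition homology_dim :: "('a::field ^ 'n \<Rightarrow> 'a ^ 'n) \<Rightarrow> nat" where
  "homology_dim D = vec.dim {x. D x = 0} - vec.dim (range D)"

text \<open>c_r(q,n): number of differentials on F^n with r-dimensional homology,
  where F = 'a (CARD('a) = q) and n = CARD('n).\<close>
definition diff_count :: "'a::{field,finite} itself \<Rightarrow> 'n::finite itself \<Rightarrow> nat \<Rightarrow> nat" where
  "diff_count _ _ r = card {D :: 'a ^ 'n \<Rightarrow> 'a ^ 'n. differential D \<and> homology_dim D = r}"

end

theory Submission
  imports Defs
begin

text \<open>A differential on \<open>F\<^sup>n\<close> with \<open>r\<close>-dimensional homology has rank \<open>k = (n - r) / 2\<close>.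
  Count the pairs \<open>(D, v)\<close> with \<open>D\<close> a differential of rank \<open>k\<close> and \<open>v\<close> a list of \<open>k\<close> vectors whose
  images \<open>D v\<close> form an ordered basis of \<open>im D\<close>. For fixed \<open>D\<close> there are
  \<open>|GL\<^sub>k(F)| q\<^bsup>k(n-k)\<^esup>\<close> such \<open>v\<close>. On the other hand \<open>v @ D v\<close> is an independent list of length \<open>2k\<close>,
  and every independent list \<open>v @ w\<close> arises from exactly \<open>q\<^bsup>k(n-2k)\<^esup>\<close> differentials, namely those
  sending \<open>v\<close> to \<open>w\<close>, killing \<open>w\<close> and mapping a complement into \<open>span w\<close>. The resulting closed
  formula for the number of differentials of rank \<open>k\<close> shows directly that passing from rank
  \<open>k\<close> to rank \<open>k + 1\<close> increases the count.\<close>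

lemma card_field_ge_2: "CARD('a::{field,finite}) \<ge> 2"
proof -
  have "card {0::'a, 1} = 2" by simp
  moreover have "card {0::'a, 1} \<le> CARD('a)" by (rule card_mono) auto
  ultimately show ?thesis by simp
qed

lemma card_span_independent:
  fixes B :: "('a::{field,finite}^'n) set"
  assumes "vec.independent B"
  shows "card (vec.span B) = CARD('a) ^ card B"
proof -
  have "finite B" using assms vec.finiteI_independent by blast
  then show ?thesis using assms
  proof (induction B rule: finite_induct)
    case empty
    then show ?case by simp
  next
    case (insert x F)
    have indF: "vec.independent F" and xF: "x \<notin> vec.span F"
      using insert.prems insert.hyps(2) by (auto simp: vec.independent_insert)
    let ?f = "\<lambda>(a, y). a *s x + y"
    have span_eq: "vec.span (insert x F) = ?f ` (UNIV \<times> vec.span F)"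
    proof (intro set_eqI iffI)
      fix y assume "y \<in> vec.span (insert x F)"
      then obtain a where "y - a *s x \<in> vec.span F" by (auto simp: vec.span_insert)
      then show "y \<in> ?f ` (UNIV \<times> vec.span F)" by (intro image_eqI[of _ _ "(a, y - a *s x)"]) auto
    next
      fix y assume "y \<in> ?f ` (UNIV \<times> vec.span F)"
      then obtain a z where "z \<in> vec.span F" "y = a *s x + z" by auto
      then show "y \<in> vec.span (insert x F)" by (auto simp: vec.span_insert intro!: exI[of _ a])
    qed
    have "inj_on ?f (UNIV \<times> vec.span F)"
    proof (rule inj_onI, clarsimp)
      fix a b y z
      assume y: "y \<in> vec.span F" and z: "z \<in> vec.span F" and eq: "a *s x + y = b *s x + z"
      show "a = b \<and> y = z"
      proof (cases "a = b")
        case False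
        have "(a - b) *s x = z - y" using eq by (simp add: vec.scale_left_diff_distrib algebra_simps)
        then have "inverse (a - b) *s (z - y) = (inverse (a - b) * (a - b)) *s x"
          by (metis vec.scale_scale)
        then have "x = inverse (a - b) *s (z - y)" using False by simp
        also have "\<dots> \<in> vec.span F" using y z by (simp add: vec.span_scale vec.span_diff)
        finally show ?thesis using xF by simp
      qed (use eq in simp)
    qed
    then have "card (vec.span (insert x F)) = CARD('a) * card (vec.span F)"
      by (simp add: span_eq card_image card_cartesian_product)
    then show ?case using insert.IH indF insert.hyps by simp
  qed
qed

lemma card_subspace:
  fixes S :: "('a::{field,finite}^'n) set"
  assumes "vec.subspace S"
  shows "card S = CARD('a) ^ vec.dim S"
proof -
  obtain B where "B \<subseteq> S" "vec.independent B" "S \<subseteq> vec.span B" "card B = vec.dim S"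
    using vec.basis_exists by blast
  then show ?thesis using card_span_independent vec.span_subspace[OF _ _ assms] by metis
qed

lemma card_linear_preimage:
  fixes D :: "'a::{field,finite}^'n \<Rightarrow> 'a^'m"
  assumes lin: "Vector_Spaces.linear (*s) (*s) D" and S: "vec.subspace S" and Y: "Y \<subseteq> D ` S"
  shows "card {x\<in>S. D x \<in> Y} = card Y * card {x\<in>S. D x = 0}"
proof -
  have fibre: "card {x\<in>S. D x = y} = card {x\<in>S. D x = 0}" if "y \<in> Y" for y
  proof -
    obtain x0 where x0: "x0 \<in> S" "y = D x0" using Y \<open>y \<in> Y\<close> by blast
    have "{x\<in>S. D x = y} = (\<lambda>z. z + x0) ` {x\<in>S. D x = 0}"
    proof (intro set_eqI iffI)
      fix x assume "x \<in> {x\<in>S. D x = y}"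
      then have "x - x0 \<in> {x\<in>S. D x = 0}"
        using x0 vec.subspace_diff[OF S] vec.linear_diff[OF lin] by auto
      then show "x \<in> (\<lambda>z. z + x0) ` {x\<in>S. D x = 0}" by (rule rev_image_eqI) simp
    qed (use x0 vec.subspace_add[OF S] vec.linear_add[OF lin] in auto)
    then show ?thesis by (simp add: card_image)
  qed
  have "{x\<in>S. D x \<in> Y} = (\<Union>y\<in>Y. {x\<in>S. D x = y})" by auto
  then have "card {x\<in>S. D x \<in> Y} = (\<Sum>y\<in>Y. card {x\<in>S. D x = y})"
    by (simp only:) (rule card_UN_disjoint, auto)
  also have "\<dots> = card Y * card {x\<in>S. D x = 0}" by (simp add: fibre)
  finally show ?thesis .
qed

lemma dim_range_add_dim_kernel:
  fixes D :: "'a::{field,finite}^'n \<Rightarrow> 'a^'m"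
  assumes lin: "Vector_Spaces.linear (*s) (*s) D"
  shows "vec.dim (range D) + vec.dim {x. D x = 0} = CARD('n)"
proof -
  have "CARD('a) ^ CARD('n) = card (range D) * card {x. D x = 0}"
    using card_linear_preimage[OF lin vec.subspace_UNIV, of "range D"] by simp
  also have "\<dots> = CARD('a) ^ (vec.dim (range D) + vec.dim {x. D x = 0})"
    using card_subspace[OF vec.linear_subspace_image[OF lin vec.subspace_UNIV]]
      card_subspace[OF vec.linear_subspace_kernel[OF lin]] by (simp add: power_add)
  finally show ?thesis using card_field_ge_2[where 'a='a] by simp
qed

text \<open>For \<open>D = id\<close> these are the linearly independent lists of vectors of \<open>W\<close>.\<close>
definition independent_lifts ::
    "('a::field^'n \<Rightarrow> 'a^'m) \<Rightarrow> ('a^'m) set \<Rightarrow> nat \<Rightarrow> ('a^'n) list set" where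
  "independent_lifts D W k =
     {vs. length vs = k \<and> distinct (map D vs) \<and> vec.independent (set (map D vs)) \<and> set (map D vs) \<subseteq> W}"

lemma Cons_in_independent_lifts_iff:
  "v # vs \<in> independent_lifts D W (Suc k) \<longleftrightarrow>
     vs \<in> independent_lifts D W k \<and> D v \<in> W - vec.span (set (map D vs))"
  unfolding independent_lifts_def using vec.span_base[of _ "set (map D vs)"]
  by (auto simp: vec.independent_insert)

lemma independent_lifts_Suc:
  "independent_lifts D W (Suc k) =
     (\<lambda>(vs, v). v # vs) ` (SIGMA vs: independent_lifts D W k. {v. D v \<in> W - vec.span (set (map D vs))})"
proof (intro set_eqI iffI)
  fix us assume us: "us \<in> independent_lifts D W (Suc k)"
  then obtain v vs where "us = v # vs" unfolding independent_lifts_def by (cases us) auto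
  with us show "us \<in> (\<lambda>(vs, v). v # vs) ` (SIGMA vs: independent_lifts D W k. {v. D v \<in> W - vec.span (set (map D vs))})"
    by (auto simp: Cons_in_independent_lifts_iff intro!: image_eqI[of _ _ "(vs, v)"])
qed (auto simp: Cons_in_independent_lifts_iff)

lemma finite_independent_lifts: "finite (independent_lifts D W k)"
  for D :: "'a::{field,finite}^'n \<Rightarrow> 'a^'m"
proof (rule finite_subset)
  show "independent_lifts D W k \<subseteq> {vs. set vs \<subseteq> UNIV \<and> length vs = k}"
    by (auto simp: independent_lifts_def)
qed (rule finite_lists_length_eq, simp)

lemma card_independent_lifts:
  fixes D :: "'a::{field,finite}^'n \<Rightarrow> 'a^'m"
  assumes lin: "Vector_Spaces.linear (*s) (*s) D" and W: "vec.subspace W" "W \<subseteq> range D"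
  shows "card (independent_lifts D W k) =
           (\<Prod>i<k. CARD('a) ^ vec.dim W - CARD('a) ^ i) * card {x. D x = 0} ^ k"
proof (induction k)
  case 0
  have "independent_lifts D W 0 = {[]}" by (auto simp: independent_lifts_def vec.independent_empty)
  then show ?case by simp
next
  case (Suc k)
  have choices: "card {v. D v \<in> W - vec.span (set (map D vs))} =
      (CARD('a) ^ vec.dim W - CARD('a) ^ k) * card {x. D x = 0}"
    if vs: "vs \<in> independent_lifts D W k" for vs
  proof -
    let ?U = "vec.span (set (map D vs))"
    have "?U \<subseteq> W" using vs vec.span_minimal[OF _ W(1)] by (auto simp: independent_lifts_def)
    moreover have "card ?U = CARD('a) ^ k"
      using vs card_span_independent distinct_card[of "map D vs"] by (auto simp: independent_lifts_def)
    ultimately have "card (W - ?U) = CARD('a) ^ vec.dim W - CARD('a) ^ k"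
      by (simp add: card_Diff_subset card_subspace[OF W(1)])
    moreover have "card {v\<in>UNIV. D v \<in> W - ?U} = card (W - ?U) * card {x\<in>UNIV. D x = 0}"
      by (rule card_linear_preimage[OF lin vec.subspace_UNIV]) (use W(2) in auto)
    ultimately show ?thesis by simp
  qed
  have "inj_on (\<lambda>(vs, v). v # vs) (SIGMA vs: independent_lifts D W k. {v. D v \<in> W - vec.span (set (map D vs))})"
    by (rule inj_onI) auto
  then have "card (independent_lifts D W (Suc k)) =
      (\<Sum>vs\<in>independent_lifts D W k. card {v. D v \<in> W - vec.span (set (map D vs))})"
    by (simp add: independent_lifts_Suc card_image finite_independent_lifts)
  also have "\<dots> = card (independent_lifts D W k) * ((CARD('a) ^ vec.dim W - CARD('a) ^ k) * card {x. D x = 0})"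
    by (simp only: sum.cong[OF refl choices] sum_constant of_nat_id)
  finally show ?case using Suc.IH by (simp add: mult_ac)
qed

lemma card_linear_maps_on_basis:
  fixes E :: "('a::{field,finite}^'n) set" and T :: "'a^'n \<Rightarrow> ('a^'m) set"
  assumes E: "vec.independent E" "vec.span E = UNIV"
  shows "card {D. Vector_Spaces.linear (*s) (*s) D \<and> (\<forall>b\<in>E. D b \<in> T b)} = (\<Prod>b\<in>E. card (T b))"
proof -
  let ?L = "{D. Vector_Spaces.linear (*s) (*s) D \<and> (\<forall>b\<in>E. D b \<in> T b)}"
  have bij: "bij_betw (\<lambda>D. restrict D E) ?L (Pi\<^sub>E E T)"
  proof (rule bij_betwI')
    fix D1 D2 assume "D1 \<in> ?L" "D2 \<in> ?L"
    then have lin: "Vector_Spaces.linear (*s) (*s) D1" "Vector_Spaces.linear (*s) (*s) D2" by simp_all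
    show "(restrict D1 E = restrict D2 E) = (D1 = D2)"
    proof
      assume eq: "restrict D1 E = restrict D2 E"
      show "D1 = D2"
      proof
        fix x
        have "D1 b = D2 b" if "b \<in> E" for b using fun_cong[OF eq, of b] that by simp
        then show "D1 x = D2 x" using vec.linear_eq_on[OF lin, of x E] E(2) by simp
      qed
    qed simp
  next
    fix g assume g: "g \<in> Pi\<^sub>E E T"
    define D where "D = vec.construct E g"
    have on_E: "D b = g b" if "b \<in> E" for b
      unfolding D_def by (rule vec.construct_basis[OF E(1) that])
    have "Vector_Spaces.linear (*s) (*s) D" unfolding D_def by (rule vec.linear_construct[OF E(1)])
    with g on_E have "D \<in> ?L" by (simp add: PiE_iff)
    moreover have "restrict D E = g"
    proof
      fix x show "restrict D E x = g x" by (cases "x \<in> E") (simp_all add: on_E PiE_arb[OF g])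
    qed
    ultimately show "\<exists>D\<in>?L. g = restrict D E" by blast
  qed (simp add: restrict_PiE_iff)
  then show ?thesis using bij_betw_same_card[OF bij] by (simp add: card_PiE)
qed

definition differentials_of_rank :: "nat \<Rightarrow> ('a::field^'n \<Rightarrow> 'a^'n) set" where
  "differentials_of_rank k = {D. differential D \<and> vec.dim (range D) = k}"

lemma differentialD:
  assumes "differential D"
  shows "Vector_Spaces.linear (*s) (*s) D" "D (D x) = 0"
  using assms unfolding differential_def by (auto dest: fun_cong[of _ _ x])

lemma homology_dim_add_double_rank:
  fixes D :: "'a::{field,finite}^'n \<Rightarrow> 'a^'n"
  assumes "differential D"
  shows "homology_dim D + 2 * vec.dim (range D) = CARD('n)"
proof -
  have "range D \<subseteq> {x. D x = 0}" using differentialD(2)[OF assms] by auto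
  then have "vec.dim (range D) \<le> vec.dim {x. D x = 0}" by (rule vec.dim_subset)
  then show ?thesis
    using dim_range_add_dim_kernel[OF differentialD(1)[OF assms]] unfolding homology_dim_def by linarith
qed

lemma diff_count_eq_card_differentials_of_rank:
  assumes "r + 2 * k = CARD('n::finite)"
  shows "diff_count TYPE('a::{field,finite}) TYPE('n) r = card (differentials_of_rank k :: ('a^'n \<Rightarrow> _) set)"
proof -
  have "homology_dim D = r \<longleftrightarrow> vec.dim (range D) = k" if "differential D" for D :: "'a^'n \<Rightarrow> 'a^'n"
    using homology_dim_add_double_rank[OF that] assms by linarith
  then have "{D :: 'a^'n \<Rightarrow> 'a^'n. differential D \<and> homology_dim D = r} = differentials_of_rank k"
    unfolding differentials_of_rank_def by blast
  then show ?thesis by (simp add: diff_count_def)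
qed

lemma append_map_in_independent_lifts:
  fixes D :: "'a::{field,finite}^'n \<Rightarrow> 'a^'n"
  assumes lin: "Vector_Spaces.linear (*s) (*s) D" and vs: "vs \<in> independent_lifts D W k"
    and DD: "\<And>v. v \<in> set vs \<Longrightarrow> D (D v) = 0"
  shows "vs @ map D vs \<in> independent_lifts id UNIV (2 * k)"
proof -
  txt \<open>\<open>S = span (vs @ D vs)\<close> maps onto a space containing \<open>span (D vs)\<close> and its kernel part also
    contains \<open>span (D vs)\<close>, so \<open>dim S \<ge> 2k\<close>, which forces the \<open>2k\<close> spanning vectors to be
    independent.\<close>
  let ?ws = "map D vs"
  define X where "X = set (vs @ ?ws)"
  define S where "S = vec.span X"
  have len: "length vs = k" and ws: "distinct ?ws" "vec.independent (set ?ws)"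
    using vs by (auto simp: independent_lifts_def)
  have card_ws: "card (vec.span (set ?ws)) = CARD('a) ^ k"
    using card_span_independent[OF ws(2)] distinct_card[OF ws(1)] len by simp
  have X_S: "X \<subseteq> S" unfolding S_def by (rule vec.span_superset)
  have S: "vec.subspace S" unfolding S_def by (rule vec.subspace_span)
  have ws_S: "set ?ws \<subseteq> S" and vs_S: "set vs \<subseteq> S" using X_S by (auto simp: X_def)
  have "vec.span (set ?ws) \<subseteq> D ` S"
  proof (rule vec.span_minimal)
    show "set ?ws \<subseteq> D ` S" using vs_S by auto
    show "vec.subspace (D ` S)" by (rule vec.linear_subspace_image[OF lin S])
  qed
  then have "card (vec.span (set ?ws)) \<le> card (D ` S)" by (rule card_mono[OF finite])
  then have "CARD('a) ^ k \<le> card (D ` S)" using card_ws by simp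
  moreover have "vec.span (set ?ws) \<subseteq> {x\<in>S. D x = 0}"
  proof (rule vec.span_minimal)
    show "set ?ws \<subseteq> {x\<in>S. D x = 0}" using ws_S DD by auto
    have "{x\<in>S. D x = 0} = S \<inter> {x. D x = 0}" by auto
    then show "vec.subspace {x\<in>S. D x = 0}"
      using vec.subspace_inter[OF S vec.linear_subspace_kernel[OF lin]] by simp
  qed
  then have "card (vec.span (set ?ws)) \<le> card {x\<in>S. D x = 0}" by (rule card_mono[OF finite])
  then have "CARD('a) ^ k \<le> card {x\<in>S. D x = 0}" using card_ws by simp
  moreover have "card S = card (D ` S) * card {x\<in>S. D x = 0}"
  proof -
    have "{x\<in>S. D x \<in> D ` S} = S" by auto
    then show ?thesis using card_linear_preimage[OF lin S subset_refl] by simp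
  qed
  ultimately have "CARD('a) ^ k * CARD('a) ^ k \<le> card S" by (simp add: mult_le_mono)
  then have "CARD('a) ^ (2 * k) \<le> CARD('a) ^ vec.dim S"
    by (simp add: card_subspace[OF S] mult_2 power_add)
  then have "2 * k \<le> vec.dim S"
    using card_field_ge_2[where 'a='a] by (simp add: power_le_imp_le_exp)
  moreover have "vec.dim S \<le> card X" using vec.dim_le_card[of S X] by (simp add: S_def)
  moreover have "card X \<le> 2 * k" using card_length[of "vs @ ?ws"] len by (simp add: X_def)
  ultimately have "card X = 2 * k" "card X = vec.dim S" by auto
  then have "distinct (vs @ ?ws)" "vec.independent X"
    using card_distinct[of "vs @ ?ws"] len vec.card_eq_dim[OF X_S] by (simp_all add: X_def S_def)
  then show ?thesis using len by (simp add: independent_lifts_def X_def)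
qed

lemma differential_of_rank_iff:
  fixes D :: "'a::{field,finite}^'n \<Rightarrow> 'a^'n"
  assumes lin: "Vector_Spaces.linear (*s) (*s) D"
    and ws: "distinct ws" "vec.independent (set ws)" "length ws = k" and vs: "map D vs = ws"
  shows "D \<in> differentials_of_rank k \<longleftrightarrow> range D \<subseteq> vec.span (set ws) \<and> (\<forall>w\<in>set ws. D w = 0)"
proof -
  have range: "vec.subspace (range D)" by (rule vec.linear_subspace_image[OF lin vec.subspace_UNIV])
  have "set ws \<subseteq> range D" using vs by auto
  then have span_range: "vec.span (set ws) \<subseteq> range D" using vec.span_minimal[OF _ range] by blast
  have dim_span: "vec.dim (vec.span (set ws)) = k"
    using vec.dim_span_eq_card_independent[OF ws(2)] distinct_card[OF ws(1)] ws(3) by simp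
  show ?thesis
  proof
    assume D: "D \<in> differentials_of_rank k"
    then have "range D = vec.span (set ws)"
      using vec.subspace_dim_equal[OF vec.subspace_span range span_range] dim_span
      by (simp add: differentials_of_rank_def)
    moreover have "D w = 0" if "w \<in> set ws" for w
      using that vs differentialD(2) D by (auto simp: differentials_of_rank_def)
    ultimately show "range D \<subseteq> vec.span (set ws) \<and> (\<forall>w\<in>set ws. D w = 0)" by simp
  next
    assume D: "range D \<subseteq> vec.span (set ws) \<and> (\<forall>w\<in>set ws. D w = 0)"
    then have range_eq: "range D = vec.span (set ws)" using span_range by blast
    have "D (D x) = 0" for x
      using D range_eq vec.linear_eq_0_on_span[OF lin, of "set ws" "D x"] by auto
    then have "differential D" using lin by (simp add: differential_def fun_eq_iff)
    then show "D \<in> differentials_of_rank k"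
      using range_eq dim_span by (simp add: differentials_of_rank_def)
  qed
qed

lemma map_eq_iff_map_of_zip:
  assumes "distinct xs" "length xs = length ys"
  shows "map f xs = ys \<longleftrightarrow> (\<forall>x\<in>set xs. map_of (zip xs ys) x = Some (f x))"
proof
  assume "\<forall>x\<in>set xs. map_of (zip xs ys) x = Some (f x)"
  then have "map_of (zip xs ys) = map_of (zip xs (map f xs))"
    using assms(2) by (auto simp: map_of_zip_map fun_eq_iff)
  then show "map f xs = ys" using map_of_zip_inject[of ys xs "map f xs"] assms by simp
qed (auto simp: map_of_zip_map)

text \<open>The values allowed on a basis vector \<open>b\<close> for a differential sending \<open>vs\<close> to \<open>ws\<close> with image
  \<open>span ws\<close>, when \<open>vs @ ws\<close> is part of the basis.\<close>
definition prescribed_values :: "('a::field^'n) list \<Rightarrow> ('a^'n) list \<Rightarrow> 'a^'n \<Rightarrow> ('a^'n) set" where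
  "prescribed_values vs ws b =
     (if b \<in> set vs then {y. map_of (zip vs ws) b = Some y}
      else if b \<in> set ws then {0} else vec.span (set ws))"

lemma linear_prescribed_values_iff:
  fixes D :: "'a::{field,finite}^'n \<Rightarrow> 'a^'n"
  assumes lin: "Vector_Spaces.linear (*s) (*s) D" and dist: "distinct (vs @ ws)"
    and len: "length vs = length ws" and E: "set (vs @ ws) \<subseteq> E" "vec.span E = UNIV"
  shows "(\<forall>b\<in>E. D b \<in> prescribed_values vs ws b) \<longleftrightarrow>
    map D vs = ws \<and> range D \<subseteq> vec.span (set ws) \<and> (\<forall>w\<in>set ws. D w = 0)"
proof -
  let ?W = "vec.span (set ws)"
  have map_iff: "map D vs = ws \<longleftrightarrow> (\<forall>b\<in>set vs. D b \<in> prescribed_values vs ws b)"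
    using map_eq_iff_map_of_zip[of vs ws D] dist len by (simp add: prescribed_values_def)
  have range_iff: "range D \<subseteq> ?W \<longleftrightarrow> D ` E \<subseteq> ?W"
  proof
    assume "D ` E \<subseteq> ?W"
    then have "vec.span (D ` E) \<subseteq> ?W" by (rule vec.span_minimal) simp
    then show "range D \<subseteq> ?W" using vec.linear_span_image[OF lin, of E] E(2) by simp
  qed auto
  have values_ws: "prescribed_values vs ws b = {0}" if "b \<in> set ws" for b
    using that dist by (auto simp: prescribed_values_def)
  have values_other: "prescribed_values vs ws b = ?W" if "b \<notin> set vs" "b \<notin> set ws" for b
    using that by (simp add: prescribed_values_def)
  show ?thesis
  proof
    assume D: "\<forall>b\<in>E. D b \<in> prescribed_values vs ws b"
    then have map_D: "map D vs = ws" using map_iff E(1) by auto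
    have kill_ws: "\<forall>w\<in>set ws. D w = 0" using D E(1) values_ws by fastforce
    have "D b \<in> ?W" if "b \<in> E" for b
    proof -
      consider "b \<in> set vs" | "b \<in> set ws" | "b \<notin> set vs" "b \<notin> set ws" by blast
      then show ?thesis
      proof cases
        case 1
        then have "D b \<in> set (map D vs)" by simp
        then show ?thesis unfolding map_D by (rule vec.span_base)
      next
        case 2
        then show ?thesis using kill_ws vec.span_zero by simp
      next
        case 3
        then show ?thesis using D that values_other by auto
      qed
    qed
    then have "range D \<subseteq> ?W" using range_iff by blast
    with map_D kill_ws show "map D vs = ws \<and> range D \<subseteq> ?W \<and> (\<forall>w\<in>set ws. D w = 0)"
      by blast
  next
    assume D: "map D vs = ws \<and> range D \<subseteq> ?W \<and> (\<forall>w\<in>set ws. D w = 0)"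
    note map_D = D[THEN conjunct1] and range_D = D[THEN conjunct2, THEN conjunct1]
      and kill_ws = D[THEN conjunct2, THEN conjunct2]
    have on_vs: "\<forall>b\<in>set vs. D b \<in> prescribed_values vs ws b" by (rule map_iff[THEN iffD1, OF map_D])
    show "\<forall>b\<in>E. D b \<in> prescribed_values vs ws b"
    proof
      fix b assume "b \<in> E"
      consider "b \<in> set vs" | "b \<in> set ws" | "b \<notin> set vs" "b \<notin> set ws" by blast
      then show "D b \<in> prescribed_values vs ws b"
      proof cases
        case 1
        then show ?thesis by (rule bspec[OF on_vs])
      next
        case 2
        then show ?thesis using bspec[OF kill_ws 2] values_ws[OF 2] by simp
      next
        case 3
        have "D b \<in> ?W" using subsetD[OF range_D rangeI] .
        then show ?thesis using values_other[OF 3] by simp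
      qed
    qed
  qed
qed

lemma card_differentials_of_rank_mapping:
  fixes vs ws :: "('a::{field,finite}^'n) list"
  assumes u: "vs @ ws \<in> independent_lifts id UNIV (2 * k)" and len: "length vs = k"
  shows "card {D \<in> differentials_of_rank k. map D vs = ws} = CARD('a) ^ (k * (CARD('n) - 2 * k))"
proof -
  define X where "X = set (vs @ ws)"
  define E where "E = vec.extend_basis X"
  have len_ws: "length ws = k" using u len by (simp add: independent_lifts_def)
  have dist: "distinct (vs @ ws)" and indep: "vec.independent X"
    using u by (auto simp: independent_lifts_def X_def)
  have ws: "distinct ws" "vec.independent (set ws)"
    using dist vec.independent_mono[OF indep] by (auto simp: X_def)
  have E: "X \<subseteq> E" "vec.independent E" "vec.span E = UNIV"
    using vec.extend_basis_superset[OF indep] vec.independent_extend_basis[OF indep]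
      vec.span_extend_basis[OF indep] by (simp_all add: E_def)
  have "{D \<in> differentials_of_rank k. map D vs = ws} =
      {D. Vector_Spaces.linear (*s) (*s) D \<and> (\<forall>b\<in>E. D b \<in> prescribed_values vs ws b)}"
  proof (intro set_eqI iffI)
    fix D assume "D \<in> {D \<in> differentials_of_rank k. map D vs = ws}"
    then have D: "D \<in> differentials_of_rank k" and map_D: "map D vs = ws" by simp_all
    then have lin: "Vector_Spaces.linear (*s) (*s) D"
      by (simp add: differentials_of_rank_def differentialD(1))
    then show "D \<in> {D. Vector_Spaces.linear (*s) (*s) D \<and> (\<forall>b\<in>E. D b \<in> prescribed_values vs ws b)}"
      using D map_D differential_of_rank_iff[OF lin ws len_ws map_D]
        linear_prescribed_values_iff[OF lin dist] E len len_ws by (simp add: X_def)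
  next
    fix D assume "D \<in> {D. Vector_Spaces.linear (*s) (*s) D \<and> (\<forall>b\<in>E. D b \<in> prescribed_values vs ws b)}"
    then have lin: "Vector_Spaces.linear (*s) (*s) D"
      and "\<forall>b\<in>E. D b \<in> prescribed_values vs ws b" by simp_all
    then have map_D: "map D vs = ws" and "range D \<subseteq> vec.span (set ws) \<and> (\<forall>w\<in>set ws. D w = 0)"
      using linear_prescribed_values_iff[OF lin dist] E len len_ws by (simp_all add: X_def)
    then show "D \<in> {D \<in> differentials_of_rank k. map D vs = ws}"
      using differential_of_rank_iff[OF lin ws len_ws map_D] by simp
  qed
  also have "card \<dots> = (\<Prod>b\<in>E. card (prescribed_values vs ws b))"
    by (rule card_linear_maps_on_basis[OF E(2,3)])
  also have "\<dots> = (\<Prod>b\<in>E - X. card (prescribed_values vs ws b)) * (\<Prod>b\<in>X. card (prescribed_values vs ws b))"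
    by (rule prod.subset_diff[OF E(1) finite])
  also have "\<dots> = card (vec.span (set ws)) ^ card (E - X)"
  proof -
    have "card (prescribed_values vs ws b) = 1" if "b \<in> X" for b
    proof (cases "b \<in> set vs")
      case True
      then obtain y where "map_of (zip vs ws) b = Some y"
        using map_of_zip_is_Some[of vs ws b] len len_ws by auto
      then show ?thesis using True by (simp add: prescribed_values_def)
    next
      case False
      then show ?thesis using that by (simp add: prescribed_values_def X_def)
    qed
    then show ?thesis by (simp add: prescribed_values_def X_def)
  qed
  also have "card (vec.span (set ws)) = CARD('a) ^ k"
    using card_span_independent[OF ws(2)] distinct_card[OF ws(1)] len_ws by simp
  also have "card (E - X) = CARD('n) - 2 * k"
  proof -
    have "card E = CARD('n)"
      using vec.basis_card_eq_dim[of E UNIV] E vec_dim_card[where 'a='a and 'n='n] by simp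
    moreover have "card X = 2 * k" using distinct_card[OF dist] len len_ws by (simp add: X_def)
    ultimately show ?thesis by (simp add: card_Diff_subset E(1))
  qed
  finally show ?thesis by (simp add: power_mult)
qed

lemma card_independent_lists_append_map:
  fixes D :: "'a::{field,finite}^'n \<Rightarrow> 'a^'n"
  assumes D: "D \<in> differentials_of_rank k"
  shows "card {u \<in> independent_lifts id UNIV (2 * k). map D (take k u) = drop k u} =
    (\<Prod>i<k. CARD('a) ^ k - CARD('a) ^ i) * CARD('a) ^ ((CARD('n) - k) * k)"
proof -
  let ?U = "{u \<in> independent_lifts id UNIV (2 * k). map D (take k u) = drop k u}"
  let ?V = "independent_lifts D (range D) k" and ?f = "\<lambda>vs. vs @ map D vs"
  have dD: "differential D" and rank: "vec.dim (range D) = k"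
    using D by (simp_all add: differentials_of_rank_def)
  note lin = differentialD(1)[OF dD]
  have "?U = ?f ` ?V"
  proof (intro set_eqI iffI)
    fix u assume "u \<in> ?U"
    then have len: "length u = 2 * k" and dist: "distinct u" and indep: "vec.independent (set u)"
      and Du: "map D (take k u) = drop k u"
      by (simp_all add: independent_lifts_def)
    have "take k u \<in> ?V"
      unfolding independent_lifts_def
    proof (intro CollectI conjI)
      show "length (take k u) = k" using len by simp
      show "distinct (map D (take k u))" using Du distinct_drop[OF dist] by simp
      show "vec.independent (set (map D (take k u)))"
        using Du vec.independent_mono[OF indep set_drop_subset] by simp
    qed auto
    moreover have "u = take k u @ map D (take k u)" using Du by simp
    ultimately show "u \<in> ?f ` ?V"
      by (intro image_eqI)
  next
    fix u assume "u \<in> ?f ` ?V"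
    then obtain vs where vs: "vs \<in> ?V" "u = vs @ map D vs" by blast
    then show "u \<in> ?U"
      using append_map_in_independent_lifts[OF lin vs(1) differentialD(2)[OF dD]]
      by (simp add: independent_lifts_def)
  qed
  moreover have "inj_on ?f ?V"
  proof (rule inj_onI)
    fix vs vs' assume "vs \<in> ?V" "vs' \<in> ?V"
      and "vs @ map D vs = vs' @ map D vs'"
    then show "vs = vs'" by (simp add: independent_lifts_def)
  qed
  ultimately have "card ?U = card (?V)"
    by (simp add: card_image)
  also have "\<dots> = (\<Prod>i<k. CARD('a) ^ k - CARD('a) ^ i) * card {x. D x = 0} ^ k"
    using card_independent_lifts[OF lin vec.linear_subspace_image[OF lin vec.subspace_UNIV] subset_refl]
    by (simp only: rank)
  also have "card {x. D x = 0} = CARD('a) ^ (CARD('n) - k)"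
  proof -
    have "vec.dim {x. D x = 0} = CARD('n) - k" using dim_range_add_dim_kernel[OF lin] rank by linarith
    then show ?thesis using card_subspace[OF vec.linear_subspace_kernel[OF lin]] by simp
  qed
  finally show ?thesis by (simp only: power_mult)
qed

lemma card_differentials_of_rank_identity:
  "card (differentials_of_rank k :: ('a::{field,finite}^'n \<Rightarrow> 'a^'n) set) *
     ((\<Prod>i<k. CARD('a) ^ k - CARD('a) ^ i) * CARD('a) ^ ((CARD('n) - k) * k)) =
   (\<Prod>i<2 * k. CARD('a) ^ CARD('n) - CARD('a) ^ i) * CARD('a) ^ (k * (CARD('n) - 2 * k))"
proof -
  let ?q = "CARD('a)" and ?n = "CARD('n)"
  let ?R = "differentials_of_rank k :: ('a^'n \<Rightarrow> 'a^'n) set"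
  let ?L = "independent_lifts (id :: 'a^'n \<Rightarrow> 'a^'n) UNIV (2 * k)"
  let ?P = "\<lambda>u D. map D (take k u) = drop k u"
  have fibres: "card {D\<in>?R. ?P u D} = ?q ^ (k * (?n - 2 * k))" if u: "u \<in> ?L" for u
  proof -
    have "length u = 2 * k" using u by (simp add: independent_lifts_def)
    then show ?thesis
      using card_differentials_of_rank_mapping[of "take k u" "drop k u" k] u by simp
  qed
  have "(\<Sum>u\<in>?L. card {D\<in>?R. ?P u D}) = (\<Prod>i<k. ?q ^ k - ?q ^ i) * ?q ^ ((?n - k) * k) * card ?R"
    by (rule sum_multicount) (simp_all add: finite_independent_lifts card_independent_lists_append_map)
  moreover have "(\<Sum>u\<in>?L. card {D\<in>?R. ?P u D}) = card ?L * ?q ^ (k * (?n - 2 * k))"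
    by (simp add: fibres)
  moreover have "card ?L = (\<Prod>i<2 * k. ?q ^ ?n - ?q ^ i)"
  proof -
    have "card ?L = (\<Prod>i<2 * k. ?q ^ vec.dim (UNIV :: ('a^'n) set) - ?q ^ i) *
        card {x :: 'a^'n. id x = 0} ^ (2 * k)"
      by (rule card_independent_lifts[OF vec.linear_id vec.subspace_UNIV]) simp
    then show ?thesis unfolding vec_dim_card by simp
  qed
  ultimately show ?thesis by (simp add: mult_ac)
qed

lemma prod_power_diff_Suc:
  fixes q :: nat
  shows "(\<Prod>i<Suc k. q ^ Suc k - q ^ i) = (q ^ Suc k - 1) * q ^ k * (\<Prod>i<k. q ^ k - q ^ i)"
proof -
  have "(\<Prod>i<Suc k. q ^ Suc k - q ^ i) = (q ^ Suc k - q ^ 0) * (\<Prod>i<k. q ^ Suc k - q ^ Suc i)"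
    by (rule prod.lessThan_Suc_shift)
  also have "(\<Prod>i<k. q ^ Suc k - q ^ Suc i) = (\<Prod>i<k. q * (q ^ k - q ^ i))"
    by (simp add: right_diff_distrib')
  finally show ?thesis by (simp add: prod.distrib)
qed

lemma rank_count_ratio_inequality:
  fixes q r j :: nat
  assumes q: "q \<ge> 2"
  shows "q ^ (j * (r + 2)) * ((q ^ Suc j - 1) * q ^ j) * q ^ ((r + j + 1) * Suc j) <
    (q ^ (r + 2 + 2 * j) - q ^ (2 * j)) * (q ^ (r + 2 + 2 * j) - q ^ (2 * j + 1)) *
      q ^ (Suc j * r) * q ^ ((r + j + 2) * j)"
proof -
  define e where "e = j * (r + 2) + j + (r + j + 1) * Suc j"
  have "q ^ (r + 2 + 2 * j) - q ^ (2 * j) = q ^ (2 * j) * (q ^ (r + 2) - 1)"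
    by (simp add: diff_mult_distrib2 power_add mult_ac)
  moreover have "q ^ (r + 2 + 2 * j) - q ^ (2 * j + 1) = q ^ (2 * j + 1) * (q ^ (r + 1) - 1)"
    by (simp add: diff_mult_distrib2 power_add mult_ac)
  moreover have "q ^ (2 * j) * q ^ (2 * j + 1) * q ^ (Suc j * r) * q ^ ((r + j + 2) * j) = q ^ j * q ^ e"
  proof -
    have "2 * j + (2 * j + 1) + Suc j * r + (r + j + 2) * j = j + e"
      by (simp add: e_def algebra_simps)
    then show ?thesis by (simp only: power_add[symmetric])
  qed
  ultimately have rhs: "(q ^ (r + 2 + 2 * j) - q ^ (2 * j)) * (q ^ (r + 2 + 2 * j) - q ^ (2 * j + 1)) *
      q ^ (Suc j * r) * q ^ ((r + j + 2) * j) = q ^ j * ((q ^ (r + 2) - 1) * (q ^ (r + 1) - 1)) * q ^ e"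
    by (simp add: mult_ac)
  have lhs: "q ^ (j * (r + 2)) * ((q ^ Suc j - 1) * q ^ j) * q ^ ((r + j + 1) * Suc j) = (q ^ Suc j - 1) * q ^ e"
    by (simp add: e_def power_add mult_ac)
  have "2 * q \<le> q * q" using q by simp
  moreover have "q * q \<le> q ^ (r + 2)" using power_increasing[of 2 "r + 2" q] q by (simp add: power2_eq_square)
  ultimately have X1: "q \<le> q ^ (r + 2) - 1" using q by linarith
  have "q \<le> q ^ (r + 1)" using power_increasing[of 1 "r + 1" q] q by simp
  then have X2: "1 \<le> q ^ (r + 1) - 1" using q by linarith
  have "q ^ j * q \<le> q ^ j * ((q ^ (r + 2) - 1) * (q ^ (r + 1) - 1))"
    using mult_le_mono[OF X1 X2] by simp
  moreover have "0 < q ^ j * q" using q by simp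
  ultimately have "q ^ Suc j - 1 < q ^ j * ((q ^ (r + 2) - 1) * (q ^ (r + 1) - 1))"
    unfolding power_Suc2 by linarith
  then show ?thesis unfolding lhs rhs using q by simp
qed

lemma card_differentials_of_rank_less:
  assumes n: "CARD('n::finite) = r + 2 + 2 * j"
  shows "card (differentials_of_rank j :: ('a::{field,finite}^'n \<Rightarrow> 'a^'n) set) <
    card (differentials_of_rank (Suc j) :: ('a^'n \<Rightarrow> 'a^'n) set)"
proof -
  let ?q = "CARD('a)" and ?n = "CARD('n)"
  define G where "G = (\<Prod>i<j. ?q ^ j - ?q ^ i)"
  define P where "P = (\<Prod>i<2 * j. ?q ^ ?n - ?q ^ i)"
  define M where "M = (?q ^ ?n - ?q ^ (2 * j)) * (?q ^ ?n - ?q ^ (2 * j + 1))"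
  define a where "a = G * ?q ^ ((r + j + 2) * j)"
  define b where "b = (?q ^ Suc j - 1) * ?q ^ j * G * ?q ^ ((r + j + 1) * Suc j)"
  have q: "?q \<ge> 2" by (rule card_field_ge_2)
  have "?n - j = r + j + 2" "?n - 2 * j = r + 2" using n by simp_all
  then have count_j: "card (differentials_of_rank j :: ('a^'n \<Rightarrow> 'a^'n) set) * a = P * ?q ^ (j * (r + 2))"
    using card_differentials_of_rank_identity[where 'a='a and 'n='n, of j]
    unfolding a_def G_def P_def by simp
  have "(\<Prod>i<2 * Suc j. ?q ^ ?n - ?q ^ i) = P * M"
  proof -
    have "2 * Suc j = Suc (Suc (2 * j))" by simp
    then show ?thesis by (simp add: P_def M_def mult_ac)
  qed
  moreover have "?n - Suc j = r + j + 1" "?n - 2 * Suc j = r" using n by simp_all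
  ultimately have count_Suc_j:
      "card (differentials_of_rank (Suc j) :: ('a^'n \<Rightarrow> 'a^'n) set) * b = P * M * ?q ^ (Suc j * r)"
    using card_differentials_of_rank_identity[where 'a='a and 'n='n, of "Suc j"]
    unfolding b_def G_def prod_power_diff_Suc by (simp add: mult_ac)
  have "P > 0" unfolding P_def
  proof (rule prod_pos)
    fix i assume "i \<in> {..<2 * j}"
    then have "i < ?n" using n by simp
    then show "0 < ?q ^ ?n - ?q ^ i" using power_strict_increasing[of i ?n ?q] q by simp
  qed
  moreover have "G > 0" unfolding G_def
  proof (rule prod_pos)
    fix i assume "i \<in> {..<j}"
    then show "0 < ?q ^ j - ?q ^ i" using power_strict_increasing[of i j ?q] q by simp
  qed
  moreover have "?q ^ (j * (r + 2)) * ((?q ^ Suc j - 1) * ?q ^ j) * ?q ^ ((r + j + 1) * Suc j) <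
      M * ?q ^ (Suc j * r) * ?q ^ ((r + j + 2) * j)"
    unfolding M_def n by (rule rank_count_ratio_inequality[OF q])
  ultimately have "P * ?q ^ (j * (r + 2)) * b < P * M * ?q ^ (Suc j * r) * a"
    unfolding a_def b_def by (simp add: mult_ac)
  then have "card (differentials_of_rank j :: ('a^'n \<Rightarrow> 'a^'n) set) * (a * b) <
      card (differentials_of_rank (Suc j) :: ('a^'n \<Rightarrow> 'a^'n) set) * (a * b)"
    unfolding count_j[symmetric] count_Suc_j[symmetric] by (simp add: mult_ac)
  then show ?thesis by (simp add: mult_less_cancel2)
qed

theorem mainTheorem7:
  fixes r :: nat
  assumes "CARD('n::finite) \<ge> 2"
    and "r mod 2 = CARD('n) mod 2"
    and "r + 2 \<le> CARD('n)"
  shows "diff_count TYPE('a::{field,finite}) TYPE('n) (r + 2) < diff_count TYPE('a) TYPE('n) r"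
proof -
  obtain j where n: "CARD('n) = r + 2 + 2 * j"
  proof
    show "CARD('n) = r + 2 + 2 * ((CARD('n) - r - 2) div 2)" using assms(2,3) by presburger
  qed
  have "diff_count TYPE('a) TYPE('n) (r + 2) = card (differentials_of_rank j :: ('a^'n \<Rightarrow> 'a^'n) set)"
    by (rule diff_count_eq_card_differentials_of_rank) (use n in simp)
  moreover have "diff_count TYPE('a) TYPE('n) r =
      card (differentials_of_rank (Suc j) :: ('a^'n \<Rightarrow> 'a^'n) set)"
    by (rule diff_count_eq_card_differentials_of_rank) (use n in simp)
  ultimately show ?thesis using card_differentials_of_rank_less[OF n] by simp
qed

end
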